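(* Let $W$ be a Coxeter group, let $\equiv$ be an essential semilattice congruence on the left weak order of $W$, and let $\mathbf S_\equiv:W\to W$ be the associated Coxeter stack-sorting operator. If $v,w\in W$ are such that $v\leq_L w$, then $\lvert\mathbf S_\equiv^{-1}(v)\rvert\geq\lvert\mathbf S_\equiv^{-1}(w)\rvert$.
   Context: Let $(W,S)$ be a Coxeter system with length function $\ell$ and identity $e$. The left weak order is $x\leq_L y\iff\ell(yx^{-1})=\ell(y)-\ell(x)$; it is a locally finite meet-semilattice with minimum $e$ (Björner). A semilattice congruence on it is an equivalence relation $\equiv$ such that $x_1\equiv x_2$ and $y_1\equiv y_2$ imply $x_1\wedge y_1\equiv x_2\wedge y_2$. It is essential if $\{e\}$ is a congruence class. Every class has a unique minimal element; $\pi_\downarrow^\equiv(w)$ denotes the minimal element of the class of $w$. The Coxeter stack-sorting operator is $\mathbf S_\equiv(w)=w\,(\pi_\downarrow^\equiv(w))^{-1}$. $\lvert\cdot\rvert$ denotes cardinality. *)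

theory Defs
  imports "HOL-Algebra.Generated_Groups" "HOL-Algebra.Lattice"
    "HOL-Library.Extended_Nat" "HOL-Library.Equipollence"
begin

section \<open>Group presentations\<close>

text \<open>A word in the free group on a set is a list of signed letters: \<open>(True, s)\<close> stands for the
  generator \<open>s\<close> and \<open>(False, s)\<close> for its formal inverse.\<close>

type_synonym 'a gword = "(bool \<times> 'a) list"

definition gwords :: "'a set \<Rightarrow> 'a gword set" where
  "gwords S = lists (UNIV \<times> S)"

text \<open>Equality of words in the free group on \<open>S\<close> modulo the normal closure of \<open>R\<close>: the congruence
  on signed words generated by free cancellation and by \<open>r = 1\<close> for \<open>r\<close> in \<open>R\<close>.\<close>

inductive pres_eq :: "'a set \<Rightarrow> 'a gword set \<Rightarrow> 'a gword \<Rightarrow> 'a gword \<Rightarrow> bool"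
  for S R where
  refl: "u \<in> gwords S \<Longrightarrow> pres_eq S R u u"
| sym: "pres_eq S R u v \<Longrightarrow> pres_eq S R v u"
| trans: "pres_eq S R u v \<Longrightarrow> pres_eq S R v w \<Longrightarrow> pres_eq S R u w"
| append: "pres_eq S R u u' \<Longrightarrow> pres_eq S R v v' \<Longrightarrow> pres_eq S R (u @ v) (u' @ v')"
| cancel: "s \<in> S \<Longrightarrow> pres_eq S R [(b, s), (\<not> b, s)] []"
| relator: "r \<in> R \<Longrightarrow> pres_eq S R r []"

definition gword_value :: "('a, 'b) monoid_scheme \<Rightarrow> 'a gword \<Rightarrow> 'a" where
  "gword_value G u =
     foldr (\<lambda>(b, s) z. (if b then s else inv\<^bsub>G\<^esub> s) \<otimes>\<^bsub>G\<^esub> z) u \<one>\<^bsub>G\<^esub>"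

definition has_presentation :: "('a, 'b) monoid_scheme \<Rightarrow> 'a set \<Rightarrow> 'a gword set \<Rightarrow> bool" where
  "has_presentation G S R \<longleftrightarrow>
     group G \<and> S \<subseteq> carrier G \<and> R \<subseteq> gwords S \<and> generate G S = carrier G \<and>
     (\<forall>u \<in> gwords S. \<forall>v \<in> gwords S. gword_value G u = gword_value G v \<longleftrightarrow> pres_eq S R u v)"

section \<open>Coxeter systems\<close>

definition coxeter_matrix :: "'a set \<Rightarrow> ('a \<Rightarrow> 'a \<Rightarrow> enat) \<Rightarrow> bool" where
  "coxeter_matrix S m \<longleftrightarrow>
     (\<forall>s \<in> S. m s s = 1) \<and>
     (\<forall>s \<in> S. \<forall>t \<in> S. m s t = m t s) \<and>
     (\<forall>s \<in> S. \<forall>t \<in> S. s \<noteq> t \<longrightarrow> m s t \<ge> 2)"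

text \<open>The relators \<open>(s t)\<^sup>m\<close> with \<open>m = m(s,t)\<close>; an infinite entry imposes no relation.\<close>

definition coxeter_relators :: "'a set \<Rightarrow> ('a \<Rightarrow> 'a \<Rightarrow> enat) \<Rightarrow> 'a gword set" where
  "coxeter_relators S m =
     {concat (replicate k [(True, s), (True, t)]) | s t k. s \<in> S \<and> t \<in> S \<and> m s t = enat k}"

text \<open>The generating set is not required to be finite.\<close>

definition coxeter_system :: "('a, 'b) monoid_scheme \<Rightarrow> 'a set \<Rightarrow> bool" where
  "coxeter_system W S \<longleftrightarrow>
     (\<exists>m. coxeter_matrix S m \<and> has_presentation W S (coxeter_relators S m))"

text \<open>Unsigned words suffice for the length, because the generators of a Coxeter system are
  involutions.\<close>

definition coxeter_length :: "('a, 'b) monoid_scheme \<Rightarrow> 'a set \<Rightarrow> 'a \<Rightarrow> nat" where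
  "coxeter_length W S w =
     (LEAST n. \<exists>xs \<in> lists S. length xs = n \<and> foldr (\<otimes>\<^bsub>W\<^esub>) xs \<one>\<^bsub>W\<^esub> = w)"

text \<open>The lengths are subtracted in the integers to avoid truncation.\<close>

definition left_weak_order :: "('a, 'b) monoid_scheme \<Rightarrow> 'a set \<Rightarrow> 'a gorder" where
  "left_weak_order W S =
     \<lparr> carrier = carrier W, eq = (=),
       le = (\<lambda>x y. int (coxeter_length W S (y \<otimes>\<^bsub>W\<^esub> inv\<^bsub>W\<^esub> x)) =
                   int (coxeter_length W S y) - int (coxeter_length W S x)) \<rparr>"

section \<open>Semilattice congruences and stack-sorting\<close>

definition semilattice_congruence :: "('a, 'b) gorder_scheme \<Rightarrow> 'a rel \<Rightarrow> bool" where
  "semilattice_congruence L r \<longleftrightarrow>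
     equiv (carrier L) r \<and>
     (\<forall>x1 x2 y1 y2. (x1, x2) \<in> r \<longrightarrow> (y1, y2) \<in> r \<longrightarrow> (x1 \<sqinter>\<^bsub>L\<^esub> y1, x2 \<sqinter>\<^bsub>L\<^esub> y2) \<in> r)"

definition essential :: "('a, 'b) monoid_scheme \<Rightarrow> 'a rel \<Rightarrow> bool" where
  "essential W r \<longleftrightarrow> {\<one>\<^bsub>W\<^esub>} \<in> carrier W // r"

definition minimal_in :: "('a, 'b) gorder_scheme \<Rightarrow> 'a set \<Rightarrow> 'a \<Rightarrow> bool" where
  "minimal_in L A x \<longleftrightarrow> x \<in> A \<and> (\<forall>y \<in> A. y \<sqsubseteq>\<^bsub>L\<^esub> x \<longrightarrow> y = x)"

definition pi_down :: "('a, 'b) gorder_scheme \<Rightarrow> 'a rel \<Rightarrow> 'a \<Rightarrow> 'a" where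
  "pi_down L r w = (THE x. minimal_in L (r `` {w}) x)"

definition stack_sort :: "('a, 'b) monoid_scheme \<Rightarrow> 'a set \<Rightarrow> 'a rel \<Rightarrow> 'a \<Rightarrow> 'a" where
  "stack_sort W S r w = w \<otimes>\<^bsub>W\<^esub> inv\<^bsub>W\<^esub> (pi_down (left_weak_order W S) r w)"

end

theory Submission
  imports Defs
begin

text \<open>
  If \<open>u\<close> is sorted to \<open>w\<close> and \<open>x\<close> is the minimum of its class, then \<open>u = w x\<close> with additive
  lengths. For \<open>v \<le>\<^sub>L w\<close> the lengths in \<open>v x\<close> are additive as well and
  \<open>x \<le>\<^sub>L v x \<le>\<^sub>L w x\<close>. Classes are convex, so \<open>v x\<close> lies in the class of \<open>x\<close> and is
  sorted to \<open>v\<close>; hence \<open>u \<mapsto> v w\<inverse> u\<close> maps the fibre over \<open>w\<close> injectively into the one over \<open>v\<close>.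

  That classes have minima needs Bjorner's theorem that the weak order has binary meets. It follows
  from the exchange property by reduction to dihedral subgroups, and the exchange property follows
  from the presentation because the parity with which a reflection occurs in a word is invariant
  under the Coxeter relations.
\<close>

section \<open>Words and length\<close>

locale coxeter_group =
  fixes W :: "('a, 'b) monoid_scheme" (structure) and S :: "'a set"
  assumes coxeter: "coxeter_system W S"
begin

lemma group_W: "group W"
  using coxeter unfolding coxeter_system_def has_presentation_def by blast

end

sublocale coxeter_group \<subseteq> group W
  by (rule group_W)

context coxeter_group
begin

abbreviation word_prod :: "'a list \<Rightarrow> 'a" where
  "word_prod xs \<equiv> foldr (\<otimes>) xs \<one>"

abbreviation len :: "'a \<Rightarrow> nat" where
  "len \<equiv> coxeter_length W S"

lemma S_carrier: "s \<in> S \<Longrightarrow> s \<in> carrier W"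
  using coxeter unfolding coxeter_system_def has_presentation_def by blast

lemma generate_S: "generate W S = carrier W"
  using coxeter unfolding coxeter_system_def has_presentation_def by blast

lemma presentation:
  obtains m where "coxeter_matrix S m" "has_presentation W S (coxeter_relators S m)"
  using coxeter unfolding coxeter_system_def by blast

lemma pres_eq_gwords:
  assumes "R \<subseteq> gwords S" "pres_eq S R u v"
  shows "u \<in> gwords S \<and> v \<in> gwords S"
  using assms(2)
  by (induction rule: pres_eq.induct) (use assms(1) in \<open>auto simp: gwords_def\<close>)

lemma pres_eq_gword_value:
  assumes "has_presentation W S R" "pres_eq S R u v"
  shows "u \<in> gwords S" "v \<in> gwords S" "gword_value W u = gword_value W v"
  using assms pres_eq_gwords[of R u v] unfolding has_presentation_def by blast+

text \<open>The diagonal entry \<open>m s s = 1\<close> makes the two-letter word \<open>s s\<close>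
  a relator.\<close>

lemma generator_square: assumes "s \<in> S" shows "s \<otimes> s = \<one>"
proof -
  obtain m where m: "coxeter_matrix S m" "has_presentation W S (coxeter_relators S m)"
    by (rule presentation)
  have "m s s = enat 1"
    using m(1) assms by (simp add: coxeter_matrix_def one_enat_def)
  then have "concat (replicate 1 [(True, s), (True, s)]) \<in> coxeter_relators S m"
    using assms unfolding coxeter_relators_def by blast
  then have "pres_eq S (coxeter_relators S m) [(True, s), (True, s)] []"
    by (intro pres_eq.relator) simp
  from pres_eq_gword_value(3)[OF m(2) this] show ?thesis
    using assms by (simp add: gword_value_def S_carrier)
qed

lemma generator_inv [simp]: "s \<in> S \<Longrightarrow> inv s = s"
  using generator_square S_carrier inv_equality by blast

lemma generator_cancel [simp]: "s \<in> S \<Longrightarrow> x \<in> carrier W \<Longrightarrow> s \<otimes> (s \<otimes> x) = x"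
  by (metis S_carrier generator_square l_one m_assoc)

lemma word_prod_closed [simp, intro]: "xs \<in> lists S \<Longrightarrow> word_prod xs \<in> carrier W"
  by (induction xs) (auto simp: S_carrier)

lemma word_prod_append:
  "xs \<in> lists S \<Longrightarrow> ys \<in> lists S \<Longrightarrow> word_prod (xs @ ys) = word_prod xs \<otimes> word_prod ys"
  by (induction xs) (auto simp: S_carrier m_assoc)

lemma word_prod_rev: "xs \<in> lists S \<Longrightarrow> word_prod (rev xs) = inv (word_prod xs)"
proof (induction xs)
  case (Cons s xs)
  then have "rev xs \<in> lists S" "s \<in> S" "xs \<in> lists S" by auto
  then show ?case
    using Cons.IH word_prod_append[of "rev xs" "[s]"]
    by (simp add: S_carrier inv_mult_group del: foldr_append)
qed simp

lemma ex_word: assumes "w \<in> carrier W" shows "\<exists>xs \<in> lists S. word_prod xs = w"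
proof -
  have "w \<in> generate W S" using assms generate_S by simp
  then show ?thesis
  proof (induction rule: generate.induct)
    case one
    show ?case by (rule bexI[of _ "[]"]) auto
  next
    case (incl h)
    then show ?case by (intro bexI[of _ "[h]"]) (auto simp: S_carrier)
  next
    \<comment> \<open>Generators are involutions, so \<open>inv h\<close> is \<open>h\<close> itself
      and unsigned letters suffice.\<close>
    case (inv h)
    then show ?case by (intro bexI[of _ "[h]"]) (auto simp: S_carrier)
  next
    case (eng h1 h2)
    then obtain xs ys where "xs \<in> lists S" "ys \<in> lists S" "word_prod xs = h1" "word_prod ys = h2"
      by blast
    then show ?case
      by (intro bexI[of _ "xs @ ys"]) (auto simp: word_prod_append simp del: foldr_append)
  qed
qed

lemma len_word_prod_le: "xs \<in> lists S \<Longrightarrow> len (word_prod xs) \<le> length xs"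
  unfolding coxeter_length_def by (rule Least_le) blast

lemma ex_reduced_word:
  assumes "w \<in> carrier W"
  obtains xs where "xs \<in> lists S" "word_prod xs = w" "length xs = len w"
proof -
  have "\<exists>n. \<exists>xs \<in> lists S. length xs = n \<and> word_prod xs = w"
    using ex_word[OF assms] by blast
  from LeastI_ex[OF this] show thesis
    using that unfolding coxeter_length_def by blast
qed

lemma len_one [simp]: "len \<one> = 0"
  using len_word_prod_le[of "[]"] by simp

lemma len_eq_0D:
  assumes "w \<in> carrier W" "len w = 0" shows "w = \<one>"
proof -
  obtain xs where "xs \<in> lists S" "word_prod xs = w" "length xs = len w"
    by (rule ex_reduced_word[OF assms(1)])
  then show ?thesis using assms(2) by auto
qed

lemma len_mult_le:
  assumes "x \<in> carrier W" "y \<in> carrier W" shows "len (x \<otimes> y) \<le> len x + len y"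
proof -
  obtain xs where "xs \<in> lists S" "word_prod xs = x" "length xs = len x"
    by (rule ex_reduced_word[OF assms(1)])
  moreover obtain ys where "ys \<in> lists S" "word_prod ys = y" "length ys = len y"
    by (rule ex_reduced_word[OF assms(2)])
  ultimately show ?thesis
    using len_word_prod_le[of "xs @ ys"] by (simp add: word_prod_append del: foldr_append)
qed

lemma len_inv: assumes "x \<in> carrier W" shows "len (inv x) = len x"
proof -
  have "len (inv y) \<le> len y" if y: "y \<in> carrier W" for y
  proof -
    obtain ys where "ys \<in> lists S" "word_prod ys = y" "length ys = len y"
      by (rule ex_reduced_word[OF y])
    then show ?thesis
      using len_word_prod_le[of "rev ys"] word_prod_rev[of ys] by (auto simp: in_lists_conv_set)
  qed
  from this[of x] this[of "inv x"] show ?thesis using assms by simp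
qed

lemma len_generator_le: "s \<in> S \<Longrightarrow> len s \<le> 1"
  using len_word_prod_le[of "[s]"] by (simp add: S_carrier)

section \<open>The exchange property\<close>

text \<open>For a word \<open>s_1 ... s_k\<close> this is the parity of the number of
  \<open>i\<close> with \<open>t = s_1 ... s_(i-1) s_i s_(i-1) ... s_1\<close>. Conjugating
  \<open>t\<close> instead of the later reflections makes it recursive in the word.\<close>

primrec refl_parity :: "'a list \<Rightarrow> 'a \<Rightarrow> bool" where
  "refl_parity [] t = False"
| "refl_parity (s # xs) t = ((t = s) \<noteq> refl_parity xs (s \<otimes> t \<otimes> s))"

text \<open>The reflections that stem from \<open>ys\<close> are conjugated by
  \<open>word_prod xs\<close>; here the conjugation is moved to \<open>t\<close>, so
  \<open>xs\<close> affects the second summand only through its value.\<close>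

lemma refl_parity_append:
  assumes "xs \<in> lists S" "t \<in> carrier W"
  shows "refl_parity (xs @ ys) t =
    (refl_parity xs t \<noteq> refl_parity ys (inv (word_prod xs) \<otimes> t \<otimes> word_prod xs))"
  using assms
  by (induction xs arbitrary: t) (auto simp: S_carrier inv_mult_group m_assoc)

text \<open>The reflections of the word \<open>(s t)\<^sup>k\<close> are the elements \<open>(s t)\<^sup>i s\<close> for \<open>i < 2 k\<close>.\<close>

lemma refl_parity_dihedral:
  assumes "s \<in> S" "t \<in> S" "x \<in> carrier W"
  shows "refl_parity (concat (replicate k [s, t])) x =
    odd (\<Sum>i < 2 * k. of_bool (x = (s \<otimes> t) [^] i \<otimes> s) :: nat)"
  using assms(3)
proof (induction k arbitrary: x)
  case 0
  then show ?case by simp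
next
  case (Suc k)
  define d where "d = s \<otimes> t"
  have S: "s \<in> carrier W" "t \<in> carrier W" "d \<in> carrier W"
    using assms by (auto simp: S_carrier d_def)
  have id: "inv d = t \<otimes> s"
    using assms by (simp add: d_def inv_mult_group S_carrier)
  \<comment> \<open>The left side conjugates \<open>x\<close> to \<open>inv d x d\<close>, and
    undoing this raises the exponent of \<open>d\<close> by two because
    \<open>s inv d = d s\<close>.\<close>
  have "(t \<otimes> (s \<otimes> x \<otimes> s) \<otimes> t = d [^] i \<otimes> s) = (x = d [^] Suc (Suc i) \<otimes> s)" for i
  proof -
    have "t \<otimes> (s \<otimes> x \<otimes> s) \<otimes> t = inv d \<otimes> x \<otimes> d"
      unfolding id using S Suc.prems by (simp add: d_def m_assoc)
    moreover have "d [^] Suc (Suc i) \<otimes> s = d \<otimes> (d [^] i \<otimes> s) \<otimes> inv d"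
    proof -
      have "s \<otimes> inv d = d \<otimes> s"
        unfolding id using S assms by (simp add: d_def m_assoc)
      then have "d \<otimes> (d [^] i \<otimes> s) \<otimes> inv d = d \<otimes> (d [^] i \<otimes> (d \<otimes> s))"
        using S by (simp add: m_assoc)
      also have "\<dots> = d [^] Suc (Suc i) \<otimes> s"
        using S nat_pow_Suc2[of d "Suc i"] by (simp add: m_assoc)
      finally show ?thesis by simp
    qed
    moreover have "(inv d \<otimes> x \<otimes> d = y) = (x = d \<otimes> y \<otimes> inv d)" if "y \<in> carrier W" for y
    proof -
      have "inv d \<otimes> (d \<otimes> z) = z" "d \<otimes> (inv d \<otimes> z) = z" if "z \<in> carrier W" for z
        using S that by (simp_all add: m_assoc[symmetric])
      then show ?thesis using S Suc.prems that by (auto simp: m_assoc)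
    qed
    ultimately show ?thesis using S by simp
  qed
  then have IH: "refl_parity (concat (replicate k [s, t])) (t \<otimes> (s \<otimes> x \<otimes> s) \<otimes> t) =
      odd (\<Sum>i < 2 * k. of_bool (x = d [^] Suc (Suc i) \<otimes> s) :: nat)"
    using Suc.IH[of "t \<otimes> (s \<otimes> x \<otimes> s) \<otimes> t"] S Suc.prems
    by (simp add: d_def[symmetric] del: nat_pow_Suc)
  \<comment> \<open>The first two letters give the summands \<open>i = 0\<close> and
    \<open>i = 1\<close>; \<open>IH\<close> covers the rest, shifted by two.\<close>
  have "(s \<otimes> x \<otimes> s = t) = (x = d \<otimes> s)"
    using S Suc.prems assms by (auto simp: d_def m_assoc generator_square)
  then show ?case
    using S assms(1,2) IH
    by (auto simp: sum.lessThan_Suc_shift d_def[symmetric] simp del: nat_pow_Suc sum.lessThan_Suc)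
qed

text \<open>Two consecutive periods have equal sums. Applied to a relator, this says that each
  reflection occurs in it an even number of times.\<close>

lemma even_sum_periodic:
  fixes f :: "nat \<Rightarrow> nat"
  assumes "\<And>i. f (i + k) = f i"
  shows "even (\<Sum>i < 2 * k. f i)"
proof -
  have "(\<Sum>i < k + n. f i) = (\<Sum>i < k. f i) + (\<Sum>i < n. f (i + k))" for n
    by (induction n) (simp_all add: add.commute)
  from this[of k] show ?thesis by (simp add: assms mult_2)
qed

section \<open>Invariance of the reflection parity under the Coxeter relations\<close>

lemma gwords_lists: "u \<in> gwords S \<Longrightarrow> map snd u \<in> lists S"
  by (induction u) (auto simp: gwords_def)

lemma gword_value_eq: "u \<in> gwords S \<Longrightarrow> gword_value W u = word_prod (map snd u)"
  by (induction u) (auto simp: gword_value_def gwords_def S_carrier)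

text \<open>Induction over the derivation. Concatenation is compatible because congruent words have
  the same value and hence conjugate \<open>t\<close> alike; free cancellation and relators
  contribute evenly.\<close>

lemma refl_parity_pres_eq:
  assumes m: "has_presentation W S (coxeter_relators S m)"
    and "pres_eq S (coxeter_relators S m) u v" "t \<in> carrier W"
  shows "refl_parity (map snd u) t = refl_parity (map snd v) t"
  using assms(2,3)
proof (induction arbitrary: t rule: pres_eq.induct)
  case (append u u' v v')
  have "u \<in> gwords S" "u' \<in> gwords S" "gword_value W u = gword_value W u'"
    using pres_eq_gword_value[OF m append.hyps(1)] by auto
  then have "map snd u \<in> lists S" "map snd u' \<in> lists S"
    "word_prod (map snd u) = word_prod (map snd u')"
    using gword_value_eq[of u] gword_value_eq[of u'] by (simp_all add: gwords_lists)
  then show ?case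
    using append by (simp add: refl_parity_append del: foldr_append)
next
  case (cancel s b)
  \<comment> \<open>Without signs the pair is \<open>s s\<close>; its conditions
    \<open>t = s\<close> and \<open>s t s = s\<close> are equivalent and cancel.\<close>
  then have "t = s \<otimes> (s \<otimes> t \<otimes> s) \<otimes> s" "s \<otimes> s \<otimes> s = s"
    using S_carrier[of s] generator_square[of s] by (simp_all add: m_assoc)
  then have "(s \<otimes> t \<otimes> s = s) = (t = s)" by metis
  then show ?case using cancel by simp
next
  case (relator w)
  have val: "word_prod (map snd w) = \<one>"
    using pres_eq_gword_value[OF m pres_eq.relator[OF relator(1)]] gword_value_eq[of w]
    by (simp add: gword_value_def)
  obtain s r k where w: "w = concat (replicate k [(True, s), (True, r)])" "s \<in> S" "r \<in> S"
    using relator(1) unfolding coxeter_relators_def by blast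
  have map: "map snd w = concat (replicate k [s, r])"
    by (simp add: w map_concat)
  have "word_prod (concat (replicate j [s, r])) = (s \<otimes> r) [^] j" for j
  proof (induction j)
    case (Suc j)
    have "(s \<otimes> r) [^] Suc j = (s \<otimes> r) \<otimes> (s \<otimes> r) [^] j"
      using nat_pow_Suc2[of "s \<otimes> r" j] w S_carrier by simp
    with Suc show ?case
      using w S_carrier by (simp add: m_assoc del: nat_pow_Suc)
  qed simp
  then have d: "(s \<otimes> r) [^] k = \<one>" using val map by metis
  \<comment> \<open>The \<open>2 k\<close> reflections of the relator thus run twice through a
    period of length \<open>k\<close>.\<close>
  have "(s \<otimes> r) [^] (i + k) = (s \<otimes> r) [^] i" for i
    using w S_carrier d by (simp add: nat_pow_mult[symmetric])
  then show ?case
    unfolding map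
    using w relator(2)
    by (simp add: refl_parity_dihedral even_sum_periodic del: sum_of_bool_eq)
qed auto

text \<open>This uses the deep direction of the presentation: words of equal value are connected by
  the Coxeter relations. Unsigned words are read as words with positive signs.\<close>

lemma refl_parity_cong:
  assumes "xs \<in> lists S" "ys \<in> lists S" "word_prod xs = word_prod ys" "t \<in> carrier W"
  shows "refl_parity xs t = refl_parity ys t"
proof -
  obtain m where m: "has_presentation W S (coxeter_relators S m)"
    by (rule presentation)
  let ?p = "map (Pair True) :: 'a list \<Rightarrow> 'a gword"
  have p: "?p zs \<in> gwords S" "map snd (?p zs) = zs" if "zs \<in> lists S" for zs
    using that by (auto simp: gwords_def comp_def)
  have "gword_value W (?p xs) = gword_value W (?p ys)"
    unfolding gword_value_eq[OF p(1)[OF assms(1)]] gword_value_eq[OF p(1)[OF assms(2)]]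
      p(2)[OF assms(1)] p(2)[OF assms(2)] by (rule assms(3))
  then have "pres_eq S (coxeter_relators S m) (?p xs) (?p ys)"
    using assms(1,2) m p(1) unfolding has_presentation_def by blast
  from refl_parity_pres_eq[OF m this assms(4)] show ?thesis
    unfolding p(2)[OF assms(1)] p(2)[OF assms(2)] .
qed

lemma lists_delete: "xs \<in> lists S \<Longrightarrow> take i xs @ drop (Suc i) xs \<in> lists S"
  by (auto dest: in_set_takeD in_set_dropD)

text \<open>Odd parity makes \<open>t\<close> the reflection \<open>p c inv p\<close> of some letter
  \<open>c\<close> preceded by a prefix with value \<open>p\<close>; multiplying by it on the left
  erases that letter.\<close>

lemma refl_parity_deletion:
  assumes "xs \<in> lists S" "t \<in> carrier W" "refl_parity xs t"
  shows "\<exists>i < length xs. t \<otimes> word_prod xs = word_prod (take i xs @ drop (Suc i) xs)"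
  using assms
proof (induction xs arbitrary: t)
  case (Cons s xs)
  then have s: "s \<in> S" "s \<in> carrier W" "xs \<in> lists S" by (auto simp: S_carrier)
  show ?case
  proof (cases "t = s")
    case True
    then show ?thesis using s by (intro exI[of _ 0]) simp
  next
    case False
    then obtain i where i: "i < length xs"
      "s \<otimes> t \<otimes> s \<otimes> word_prod xs = word_prod (take i xs @ drop (Suc i) xs)"
      using Cons.IH[of "s \<otimes> t \<otimes> s"] Cons.prems s by auto
    have "t \<otimes> word_prod (s # xs) = s \<otimes> (s \<otimes> t \<otimes> s \<otimes> word_prod xs)"
      using s Cons.prems by (simp add: m_assoc)
    then show ?thesis using i by (intro exI[of _ "Suc i"]) simp
  qed
qed simp

lemma refl_parity_imp_len_less:
  assumes "xs \<in> lists S" "t \<in> carrier W" "refl_parity xs t"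
  shows "len (t \<otimes> word_prod xs) < length xs"
proof -
  obtain i where i: "i < length xs" "t \<otimes> word_prod xs = word_prod (take i xs @ drop (Suc i) xs)"
    using refl_parity_deletion[OF assms] by blast
  then show ?thesis
    using len_word_prod_le[OF lists_delete[OF assms(1), of i]] by simp
qed

text \<open>A generator is always an odd reflection of exactly one of \<open>x\<close> and \<open>s x\<close>, so an odd
  reflection of the longer one.\<close>

lemma refl_parity_generator:
  assumes "xs \<in> lists S" "s \<in> S" "len (s \<otimes> word_prod xs) \<le> len (word_prod xs)"
  shows "refl_parity xs s"
proof -
  obtain ys where ys: "ys \<in> lists S" "word_prod ys = s \<otimes> word_prod xs"
    "length ys = len (s \<otimes> word_prod xs)"
    using assms S_carrier ex_reduced_word[of "s \<otimes> word_prod xs"] by blast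
  \<comment> \<open>As \<open>ys\<close> is reduced, \<open>s\<close> being odd in it would give
    \<open>len (word_prod xs) < length ys\<close>, against the hypothesis.\<close>
  have "\<not> refl_parity ys s"
    using refl_parity_imp_len_less[OF ys(1), of s] ys assms S_carrier by auto
  then have "refl_parity (s # ys) s"
    using assms(2) by (simp add: generator_square S_carrier)
  then show ?thesis
    using refl_parity_cong[of "s # ys" xs s] ys assms(1,2) S_carrier by simp
qed

lemma exchange:
  assumes "xs \<in> lists S" "s \<in> S" "len (s \<otimes> word_prod xs) \<le> len (word_prod xs)"
  shows "\<exists>i < length xs. s \<otimes> word_prod xs = word_prod (take i xs @ drop (Suc i) xs)"
  using refl_parity_deletion[OF assms(1) S_carrier[OF assms(2)] refl_parity_generator[OF assms]] .

text \<open>No reflection occurs in the empty word, so the parity criterion excludes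
  \<open>len s = 0\<close>.\<close>

lemma len_generator: assumes "s \<in> S" shows "len s = 1"
proof -
  have "\<not> len s \<le> 0"
    using refl_parity_generator[of "[]" s] assms S_carrier[of s] by auto
  then show ?thesis using len_generator_le[OF assms] by simp
qed

section \<open>The prefix order and its meets\<close>

text \<open>The right weak order: some reduced word of \<open>y\<close> begins with a reduced word
  of \<open>x\<close>. Inversion carries the left weak order to it, and it suits words that are
  peeled from the front.\<close>

definition prefix_le :: "'a \<Rightarrow> 'a \<Rightarrow> bool" where
  "prefix_le x y \<longleftrightarrow> len y = len x + len (inv x \<otimes> y)"

lemma inv_mult_cancel [simp]:
  assumes "x \<in> carrier W" "y \<in> carrier W"
  shows "inv x \<otimes> (x \<otimes> y) = y" "x \<otimes> (inv x \<otimes> y) = y"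
  using assms by (simp_all add: m_assoc[symmetric])

lemma inv_mult_mult_cancel:
  assumes "p \<in> carrier W" "a \<in> carrier W" "b \<in> carrier W"
  shows "inv (p \<otimes> a) \<otimes> (p \<otimes> b) = inv a \<otimes> b"
  using assms by (simp add: inv_mult_group m_assoc)

lemma prefix_le_mult:
  "x \<in> carrier W \<Longrightarrow> y \<in> carrier W \<Longrightarrow> prefix_le x (x \<otimes> y) \<longleftrightarrow> len (x \<otimes> y) = len x + len y"
  by (simp add: prefix_le_def)

lemma prefix_le_generator:
  "s \<in> S \<Longrightarrow> prefix_le s x \<longleftrightarrow> len x = Suc (len (s \<otimes> x))"
  by (simp add: prefix_le_def len_generator)

lemma prefix_le_refl: "x \<in> carrier W \<Longrightarrow> prefix_le x x"
  by (simp add: prefix_le_def)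

lemma prefix_le_one: "x \<in> carrier W \<Longrightarrow> prefix_le \<one> x"
  by (simp add: prefix_le_def)

lemma prefix_le_len: "prefix_le x y \<Longrightarrow> len x \<le> len y"
  by (simp add: prefix_le_def)

lemma prefix_le_trans:
  assumes "prefix_le x y" "prefix_le y z" "x \<in> carrier W" "y \<in> carrier W" "z \<in> carrier W"
  shows "prefix_le x z"
proof -
  have "len (inv x \<otimes> y \<otimes> (inv y \<otimes> z)) \<le> len (inv x \<otimes> y) + len (inv y \<otimes> z)"
    using assms by (intro len_mult_le) auto
  moreover have "inv x \<otimes> y \<otimes> (inv y \<otimes> z) = inv x \<otimes> z"
    using assms by (simp add: m_assoc)
  moreover have "len (x \<otimes> (inv x \<otimes> z)) \<le> len x + len (inv x \<otimes> z)"
    using assms by (intro len_mult_le) auto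
  ultimately show ?thesis using assms by (simp add: prefix_le_def)
qed

text \<open>Antisymmetry with a mere length comparison in one direction, so that it applies to
  elements of extremal length.\<close>

lemma prefix_le_len_antisym:
  assumes "prefix_le x y" "len y \<le> len x" "x \<in> carrier W" "y \<in> carrier W"
  shows "x = y"
proof -
  have "len (inv x \<otimes> y) = 0" using assms by (simp add: prefix_le_def)
  then have "inv x \<otimes> y = \<one>" using assms by (intro len_eq_0D) auto
  then have "x \<otimes> (inv x \<otimes> y) = x" using assms by simp
  then show ?thesis using assms by simp
qed

text \<open>In \<open>p b = (p a)(inv a b)\<close> any loss of length in \<open>p a\<close> would be
  a loss in \<open>p b\<close>.\<close>

lemma prefix_le_left_mult:
  assumes "p \<in> carrier W" "a \<in> carrier W" "b \<in> carrier W"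
    and "len (p \<otimes> b) = len p + len b" "prefix_le a b"
  shows "len (p \<otimes> a) = len p + len a" "prefix_le (p \<otimes> a) (p \<otimes> b)"
proof -
  have "len (p \<otimes> a \<otimes> (inv a \<otimes> b)) \<le> len (p \<otimes> a) + len (inv a \<otimes> b)"
    using assms by (intro len_mult_le) auto
  moreover have "p \<otimes> a \<otimes> (inv a \<otimes> b) = p \<otimes> b"
    using assms by (simp add: m_assoc)
  moreover have "len (p \<otimes> a) \<le> len p + len a"
    using assms by (intro len_mult_le) auto
  ultimately show *: "len (p \<otimes> a) = len p + len a"
    using assms by (simp add: prefix_le_def)
  then show "prefix_le (p \<otimes> a) (p \<otimes> b)"
    using assms by (simp add: prefix_le_def inv_mult_mult_cancel)
qed

lemma prefix_le_generator_cancel: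
  assumes "s \<in> S" "a \<in> carrier W" "b \<in> carrier W" "prefix_le s a" "prefix_le s b"
  shows "prefix_le (s \<otimes> a) (s \<otimes> b) \<longleftrightarrow> prefix_le a b"
  using assms S_carrier[of s]
  by (simp add: prefix_le_generator) (simp add: prefix_le_def inv_mult_mult_cancel)

lemma ex_generator_prefix:
  assumes "u \<in> carrier W" "u \<noteq> \<one>"
  obtains s where "s \<in> S" "prefix_le s u"
proof -
  obtain xs where xs: "xs \<in> lists S" "word_prod xs = u" "length xs = len u"
    by (rule ex_reduced_word[OF assms(1)])
  then obtain s ys where [simp]: "xs = s # ys" using assms(2) by (cases xs) auto
  have s: "s \<in> S" "s \<in> carrier W" "ys \<in> lists S" using xs by (auto simp: S_carrier)
  have "len u \<le> len s + len (word_prod ys)"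
    using len_mult_le[of s "word_prod ys"] xs s by auto
  moreover have "s \<otimes> u = word_prod ys"
    using xs(2) generator_cancel[OF s(1) word_prod_closed[OF s(3)]] by auto
  ultimately have "prefix_le s u"
    using xs s len_word_prod_le[of ys] len_generator[of s] by (simp add: prefix_le_generator)
  then show thesis using s that by blast
qed

text \<open>A shorter word for the prefix would shorten the whole reduced word.\<close>

lemma len_word_prod_take:
  assumes "xs \<in> lists S" "len (word_prod xs) = length xs" "i \<le> length xs"
  shows "len (word_prod (take i xs)) = i"
proof -
  have l: "take i xs \<in> lists S" "drop i xs \<in> lists S"
    using assms by (auto dest: in_set_takeD in_set_dropD)
  have "len (word_prod (take i xs @ drop i xs)) \<le>
      len (word_prod (take i xs)) + len (word_prod (drop i xs))"
    unfolding word_prod_append[OF l] using l by (intro len_mult_le) auto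
  then show ?thesis
    using assms l[THEN len_word_prod_le] by simp
qed

section \<open>Alternating words and braid relations\<close>

primrec alternating :: "nat \<Rightarrow> 'a \<Rightarrow> 'a \<Rightarrow> 'a list" where
  "alternating 0 s t = []"
| "alternating (Suc n) s t = s # alternating n t s"

lemma alternating_lists [simp]: "s \<in> S \<Longrightarrow> t \<in> S \<Longrightarrow> alternating n s t \<in> lists S"
  by (induction n arbitrary: s t) auto

lemma length_alternating [simp]: "length (alternating n s t) = n"
  by (induction n arbitrary: s t) auto

lemma take_alternating: "i \<le> n \<Longrightarrow> take i (alternating n s t) = alternating i s t"
proof (induction n arbitrary: i s t)
  case (Suc n)
  then show ?case by (cases i) auto
qed simp

lemma alternating_Suc_snoc:
  "alternating (Suc n) s t = alternating n s t @ [if even n then s else t]"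
  by (induction n arbitrary: s t) auto

text \<open>Repeated exchange: either the alternating prefix of \<open>x\<close> can be lengthened on the left, or
  the deleted letter lies in the prefix and yields a braid relation.\<close>

lemma alternating_prefix:
  assumes "a \<in> S" "b \<in> S" "q \<in> carrier W" "prefix_le a x" "prefix_le b x"
    and "x = word_prod (alternating m a b) \<otimes> q" "len x = m + len q"
  shows "\<exists>n \<ge> 1. word_prod (alternating n a b) = word_prod (alternating n b a) \<and>
    len (word_prod (alternating n a b)) = n \<and> prefix_le (word_prod (alternating n a b)) x"
  using assms
proof (induction "len q" arbitrary: a b q m rule: less_induct)
  case less
  let ?A = "alternating m a b"
  have ab: "a \<in> carrier W" "b \<in> carrier W" using less.prems S_carrier by auto
  obtain qs where qs: "qs \<in> lists S" "word_prod qs = q" "length qs = len q"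
    by (rule ex_reduced_word[OF less.prems(3)])
  have A: "?A \<in> lists S" "word_prod ?A \<in> carrier W"
    using less.prems by auto
  have w: "?A @ qs \<in> lists S" "word_prod (?A @ qs) = x" "length (?A @ qs) = len x"
    unfolding word_prod_append[OF A(1) qs(1)] using less.prems A qs by auto
  have x: "x \<in> carrier W" using w by blast
  have lt: "len (b \<otimes> x) < len x"
    using less.prems by (simp add: prefix_le_generator)
  then obtain i where i: "i < m + len q"
    "b \<otimes> x = word_prod (take i (?A @ qs) @ drop (Suc i) (?A @ qs))"
    using exchange[OF w(1) less.prems(2)] w(2,3) less.prems(7) by auto
  show ?case
  proof (cases "i < m")
    case False
    \<comment> \<open>The deleted letter lies in \<open>q\<close>, so \<open>x = b A q'\<close> with
      \<open>A\<close> the alternating prefix. Putting \<open>b\<close> in front lengthens the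
      prefix, and the induction continues with \<open>a\<close> and \<open>b\<close>
      swapped.\<close>
    define q' where "q' = word_prod (take (i - m) qs @ drop (Suc i - m) qs)"
    have l: "take (i - m) qs @ drop (Suc i - m) qs \<in> lists S"
      using qs(1) by (auto dest: in_set_takeD in_set_dropD)
    have "length (take (i - m) qs @ drop (Suc i - m) qs) < len q"
      using qs(3) i(1) False by auto
    then have q': "q' \<in> carrier W" "len q' < len q"
      unfolding q'_def using word_prod_closed[OF l] len_word_prod_le[OF l] by linarith+
    have "b \<otimes> x = word_prod (?A @ (take (i - m) qs @ drop (Suc i - m) qs))"
      using i(2) False by simp
    then have "b \<otimes> x = word_prod ?A \<otimes> q'"
      unfolding q'_def word_prod_append[OF A(1) l] .
    then have "b \<otimes> (b \<otimes> x) = b \<otimes> (word_prod ?A \<otimes> q')" by simp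
    then have x': "x = word_prod (alternating (Suc m) b a) \<otimes> q'"
      using A q' ab x less.prems(2) by (simp add: m_assoc)
    have "len x \<le> len (word_prod (alternating (Suc m) b a)) + len q'"
      unfolding x' using less.prems q' by (intro len_mult_le word_prod_closed) auto
    moreover have "len (word_prod (alternating (Suc m) b a)) \<le> Suc m"
      using len_word_prod_le[of "alternating (Suc m) b a"] less.prems by simp
    ultimately have "len x = Suc m + len q'"
      using less.prems(7) q'(2) by linarith
    from less.hyps[OF q'(2) less.prems(2,1) q'(1) less.prems(5,4) x' this]
    show ?thesis by metis
  next
    case True
    \<comment> \<open>Cancelling the common tail \<open>?D\<close> leaves \<open>b\<close> times the
      first \<open>Suc i\<close> letters equal to the first \<open>i\<close> letters; multiplying by
      \<open>b\<close> gives the braid relation of length \<open>Suc i\<close>.\<close>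
    let ?D = "drop (Suc i) ?A @ qs"
    have D: "?D \<in> lists S" "word_prod ?D \<in> carrier W"
    proof -
      show "?D \<in> lists S" using A(1) qs(1) by (auto dest: in_set_dropD)
      then show "word_prod ?D \<in> carrier W" by (rule word_prod_closed)
    qed
    have t: "alternating k a b \<in> lists S" "word_prod (alternating k a b) \<in> carrier W" for k
      using less.prems by auto
    have split: "?A @ qs = alternating (Suc i) a b @ ?D"
      using True take_alternating[of "Suc i" m a b] append_take_drop_id[of "Suc i" ?A] by simp
    have "b \<otimes> x = word_prod (alternating i a b @ ?D)"
      using i(2) True by (simp add: take_alternating)
    then have "b \<otimes> word_prod (alternating (Suc i) a b @ ?D) = word_prod (alternating i a b @ ?D)"
      using w(2) unfolding split by simp
    then have "b \<otimes> word_prod (alternating (Suc i) a b) \<otimes> word_prod ?D =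
        word_prod (alternating i a b) \<otimes> word_prod ?D"
      unfolding word_prod_append[OF t(1) D(1)] m_assoc[OF ab(2) t(2) D(2)] .
    then have "b \<otimes> word_prod (alternating (Suc i) a b) = word_prod (alternating i a b)"
      using right_cancel[OF D(2) m_closed[OF ab(2) t(2)] t(2)] by blast
    then have "b \<otimes> (b \<otimes> word_prod (alternating (Suc i) a b)) =
        b \<otimes> word_prod (alternating i a b)" by simp
    then have eq: "word_prod (alternating (Suc i) a b) = word_prod (alternating (Suc i) b a)"
      using less.prems(2) t(2)[of "Suc i"] by simp
    have tk: "len (word_prod (alternating (Suc i) a b)) = Suc i"
      using len_word_prod_take[of "?A @ qs" "Suc i"] w True
      by (simp add: take_alternating)
    have "len (word_prod ?D) \<le> length ?D" using D(1) by (rule len_word_prod_le)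
    also have "length ?D = len x - Suc i" using w(3) True by simp
    finally have "len x = Suc i + len (word_prod ?D)"
      using len_mult_le[OF t(2) D(2), of "Suc i"] tk w(2,3) True
      unfolding split word_prod_append[OF t(1) D(1)] by simp
    moreover have "x = word_prod (alternating (Suc i) a b) \<otimes> word_prod ?D"
      using w(2) unfolding split word_prod_append[OF t(1) D(1)] by simp
    ultimately have "prefix_le (word_prod (alternating (Suc i) a b)) x"
      using prefix_le_mult[OF t(2) D(2), of "Suc i"] tk by simp
    with eq tk show ?thesis by (intro exI[of _ "Suc i"]) simp
  qed
qed

text \<open>The braid relation rewrites the first \<open>m\<close> letters of
  \<open>alternating (Suc m) s t\<close> so that they end in the letter that follows. The two equal
  letters cancel, so this word and every longer one is not reduced.\<close>

lemma braid_length_le: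
  assumes "s \<in> S" "t \<in> S" "m \<ge> 1"
    and "word_prod (alternating m s t) = word_prod (alternating m t s)"
    and "len (word_prod (alternating n s t)) = n"
  shows "n \<le> m"
proof (rule ccontr)
  assume "\<not> n \<le> m"
  then have len_eq: "len (word_prod (alternating (Suc m) s t)) = Suc m"
    using len_word_prod_take[of "alternating n s t" "Suc m"] assms by (simp add: take_alternating)
  obtain k where k: "m = Suc k" using assms(3) by (cases m) auto
  \<comment> \<open>\<open>c\<close> is the last letter both of
    \<open>alternating (Suc m) s t\<close> and of \<open>alternating m t s\<close>.\<close>
  define c where "c = (if even m then s else t)"
  have c: "c \<in> S" "c \<in> carrier W" using assms S_carrier by (auto simp: c_def)
  have l: "alternating j s t \<in> lists S" "alternating j t s \<in> lists S" for j
    using assms by auto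
  have cl: "[c] \<in> lists S" using c by simp
  have "word_prod (alternating (Suc m) s t) = word_prod (alternating m s t) \<otimes> c"
    unfolding alternating_Suc_snoc c_def[symmetric] word_prod_append[OF l(1) cl] using c by simp
  also have "\<dots> = word_prod (alternating k t s @ [c]) \<otimes> c"
    unfolding assms(4) unfolding k alternating_Suc_snoc c_def by simp
  also have "\<dots> = word_prod (alternating k t s)"
    unfolding word_prod_append[OF l(2) cl]
    using c word_prod_closed[OF l(2)] by (simp add: m_assoc generator_square)
  finally have "len (word_prod (alternating (Suc m) s t)) \<le> k"
    using len_word_prod_le[OF l(2), of k] by (simp del: alternating.simps)
  then show False using k len_eq by simp
qed

lemma generator_prefix_alternating:
  assumes "s \<in> S" "t \<in> S" "n \<ge> 1" "len (word_prod (alternating n s t)) = n"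
  shows "prefix_le s (word_prod (alternating n s t))"
proof -
  obtain k where k: "n = Suc k" using assms(3) by (cases n) auto
  have l: "alternating k t s \<in> lists S" "word_prod (alternating k t s) \<in> carrier W"
    using assms by auto
  then have "prefix_le s (s \<otimes> word_prod (alternating k t s))"
    using assms S_carrier[of s] len_mult_le[of s "word_prod (alternating k t s)"]
      len_word_prod_le[OF l(1)] len_generator[of s]
    by (subst prefix_le_mult) (auto simp: k)
  then show ?thesis by (simp add: k)
qed

text \<open>Both \<open>x\<close> and \<open>y\<close> have a reduced alternating prefix satisfying
  a braid relation. \<open>braid_length_le\<close> in both directions forces equal lengths, so the
  two prefixes are the same element \<open>d\<close>.\<close>

lemma generators_upper_bound:
  assumes "s \<in> S" "t \<in> S" "x \<in> carrier W" "y \<in> carrier W"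
    and "prefix_le s x" "prefix_le t x" "prefix_le s y" "prefix_le t y"
  obtains d where "d \<in> carrier W" "prefix_le s d" "prefix_le t d" "prefix_le d x" "prefix_le d y"
proof -
  \<comment> \<open>The repeated exchange starts from the empty alternating prefix, with
    \<open>q = x\<close>.\<close>
  obtain m where m: "m \<ge> 1" "word_prod (alternating m s t) = word_prod (alternating m t s)"
    "len (word_prod (alternating m s t)) = m" "prefix_le (word_prod (alternating m s t)) x"
    using alternating_prefix[of s t x x 0] assms by auto
  obtain n where n: "n \<ge> 1" "word_prod (alternating n s t) = word_prod (alternating n t s)"
    "len (word_prod (alternating n s t)) = n" "prefix_le (word_prod (alternating n s t)) y"
    using alternating_prefix[of s t y y 0] assms by auto
  have "m = n"
    using braid_length_le[OF assms(1,2) m(1,2) n(3)] braid_length_le[OF assms(1,2) n(1,2) m(3)]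
    by simp
  have "prefix_le t (word_prod (alternating m s t))"
    unfolding m(2) using generator_prefix_alternating[OF assms(2,1) m(1)] m(2,3) by simp
  moreover have "prefix_le s (word_prod (alternating m s t))"
    using generator_prefix_alternating[OF assms(1,2) m(1,3)] .
  ultimately show thesis
    using that[of "word_prod (alternating m s t)"] m(4) n(4) \<open>m = n\<close> assms(1,2) by simp
qed

text \<open>If \<open>s\<close> and \<open>t\<close> are first letters of \<open>u\<close> and \<open>z\<close>, a common upper bound \<open>d\<close> of \<open>s\<close> and \<open>t\<close>
  below \<open>x\<close> and \<open>y\<close> connects them: cancelling \<open>t\<close> gives \<open>d \<le> z\<close>, hence \<open>s \<le> z\<close>, and cancelling
  \<open>s\<close> gives \<open>u \<le> z\<close>.\<close>

lemma maximal_lower_bound_greatest: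
  assumes "x \<in> carrier W" "y \<in> carrier W" "z \<in> carrier W" "u \<in> carrier W"
    and "prefix_le z x" "prefix_le z y" "prefix_le u x" "prefix_le u y"
    and "\<And>v. v \<in> carrier W \<Longrightarrow> prefix_le v x \<Longrightarrow> prefix_le v y \<Longrightarrow> prefix_le z v \<Longrightarrow> v = z"
  shows "prefix_le u z"
  using assms
proof (induction "len z" arbitrary: x y z u rule: less_induct)
  case less
  note carr = less.prems(1-4)
  \<comment> \<open>A first letter \<open>s\<close> common to \<open>z\<close> and \<open>u'\<close>
    is removed from \<open>x\<close>, \<open>y\<close>, \<open>z\<close> and \<open>u'\<close>, and
    the induction hypothesis applies to the shorter \<open>s z\<close>.\<close>
  have cancel: "prefix_le u' z"
    if s: "s \<in> S" "prefix_le s z" "prefix_le s u'"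
      and u': "u' \<in> carrier W" "prefix_le u' x" "prefix_le u' y" for s u'
  proof -
    have sc: "s \<in> carrier W" using s S_carrier by blast
    have sxy: "prefix_le s x" "prefix_le s y"
      using prefix_le_trans[OF s(2) less.prems(5) sc] prefix_le_trans[OF s(2) less.prems(6) sc] carr
      by auto
    have "prefix_le (s \<otimes> u') (s \<otimes> z)"
    proof (rule less.hyps[of _ "s \<otimes> x" "s \<otimes> y"])
      show "len (s \<otimes> z) < len z"
        using s by (simp add: prefix_le_generator)
      show "prefix_le (s \<otimes> z) (s \<otimes> x)" "prefix_le (s \<otimes> z) (s \<otimes> y)"
        "prefix_le (s \<otimes> u') (s \<otimes> x)" "prefix_le (s \<otimes> u') (s \<otimes> y)"
        using prefix_le_generator_cancel[OF s(1)] carr less.prems(5,6) s u' sxy by simp_all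
    next
      fix v
      assume v: "v \<in> carrier W" "prefix_le v (s \<otimes> x)" "prefix_le v (s \<otimes> y)"
        "prefix_le (s \<otimes> z) v"
      \<comment> \<open>Multiplied back, \<open>s v\<close> is a common lower bound of
        \<open>x\<close> and \<open>y\<close> above \<open>z\<close>, so the maximality of
        \<open>z\<close> passes to \<open>s z\<close>.\<close>
      have "len (s \<otimes> (s \<otimes> x)) = len s + len (s \<otimes> x)" "len (s \<otimes> (s \<otimes> y)) = len s + len (s \<otimes> y)"
        using sxy s(1) carr by (simp_all add: prefix_le_generator len_generator)
      then have *: "len (s \<otimes> v) = len s + len v" "prefix_le (s \<otimes> v) x" "prefix_le (s \<otimes> v) y"
        using prefix_le_left_mult[of s v "s \<otimes> x"] prefix_le_left_mult[of s v "s \<otimes> y"]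
          v s(1) sc carr by simp_all
      then have "prefix_le z (s \<otimes> v)"
        using prefix_le_left_mult(2)[of s "s \<otimes> z" v] v s(1) sc carr by simp
      then have "s \<otimes> v = z" using less.prems(9) * v sc by simp
      then show "v = s \<otimes> z" using s(1) v by auto
    qed (use sc carr u' in auto)
    then show ?thesis
      using prefix_le_generator_cancel[OF s(1)] carr s u' by simp
  qed
  show ?case
  proof (cases "u = \<one>")
    case True
    then show ?thesis using carr prefix_le_one by simp
  next
    case False
    then obtain s where s: "s \<in> S" "prefix_le s u"
      using ex_generator_prefix carr by blast
    have sc: "s \<in> carrier W" using s S_carrier by blast
    have sxy: "prefix_le s x" "prefix_le s y"
      using prefix_le_trans[OF s(2) less.prems(7) sc] prefix_le_trans[OF s(2) less.prems(8) sc] carr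
      by auto
    show ?thesis
    proof (cases "z = \<one>")
      case True
      \<comment> \<open>\<open>s\<close> is a common lower bound above \<open>z = \<one>\<close>, so
        maximality would make this generator trivial.\<close>
      then have "s = \<one>"
        using less.prems(9)[of s] sc sxy prefix_le_one by simp
      then show ?thesis using len_generator[OF s(1)] by simp
    next
      case False
      then obtain t where t: "t \<in> S" "prefix_le t z"
        using ex_generator_prefix carr by blast
      have tc: "t \<in> carrier W" using t S_carrier by blast
      have txy: "prefix_le t x" "prefix_le t y"
        using prefix_le_trans[OF t(2) less.prems(5) tc] prefix_le_trans[OF t(2) less.prems(6) tc]
          carr by auto
      obtain d where d: "d \<in> carrier W" "prefix_le s d" "prefix_le t d" "prefix_le d x" "prefix_le d y"
        using generators_upper_bound[OF s(1) t(1) carr(1,2) sxy(1) txy(1) sxy(2) txy(2)] by blast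
      have "prefix_le d z" by (rule cancel[OF t d(3,1,4,5)])
      then have "prefix_le s z" using prefix_le_trans[OF d(2)] sc d(1) carr by blast
      then show ?thesis using cancel[OF s(1) _ s(2) carr(4) less.prems(7,8)] by blast
    qed
  qed
qed

text \<open>The witness is a common lower bound of greatest length, which exists because lengths are
  bounded by \<open>len x\<close>; greatest length implies maximality.\<close>

lemma prefix_meet_exists:
  assumes "x \<in> carrier W" "y \<in> carrier W"
  obtains z where "z \<in> carrier W" "prefix_le z x" "prefix_le z y"
    "\<And>u. u \<in> carrier W \<Longrightarrow> prefix_le u x \<Longrightarrow> prefix_le u y \<Longrightarrow> prefix_le u z"
proof -
  let ?P = "\<lambda>z. z \<in> carrier W \<and> prefix_le z x \<and> prefix_le z y"
  have "?P \<one>" using assms prefix_le_one by simp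
  moreover have "\<forall>z. ?P z \<longrightarrow> len z < Suc (len x)"
    using prefix_le_len by (simp add: le_imp_less_Suc)
  ultimately obtain z where z: "?P z" "\<And>u. ?P u \<Longrightarrow> len u \<le> len z"
    using ex_has_greatest_nat[of ?P \<one> len] by blast
  have "prefix_le u z" if "?P u" for u
  proof (rule maximal_lower_bound_greatest[of x y])
    fix v assume "v \<in> carrier W" "prefix_le v x" "prefix_le v y" "prefix_le z v"
    then show "v = z" using prefix_le_len_antisym[of z v] z by auto
  qed (use that z assms in auto)
  then show thesis using that z by blast
qed

section \<open>The left weak order and stack-sorting\<close>

abbreviation weak :: "'a gorder" where
  "weak \<equiv> left_weak_order W S"

lemma carrier_weak [simp]: "carrier weak = carrier W"
  by (simp add: left_weak_order_def)

lemma weak_le_iff: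
  "x \<sqsubseteq>\<^bsub>weak\<^esub> y \<longleftrightarrow> len y = len (y \<otimes> inv x) + len x"
  by (auto simp: left_weak_order_def)

lemma weak_le_iff_prefix_le:
  assumes "x \<in> carrier W" "y \<in> carrier W"
  shows "x \<sqsubseteq>\<^bsub>weak\<^esub> y \<longleftrightarrow> prefix_le (inv x) (inv y)"
proof -
  have "len (y \<otimes> inv x) = len (x \<otimes> inv y)"
    using len_inv[of "y \<otimes> inv x"] assms by (simp add: inv_mult_group)
  then show ?thesis
    using assms by (auto simp: weak_le_iff prefix_le_def len_inv)
qed

lemma weak_le_mult:
  assumes "x \<in> carrier W" "g \<in> carrier W"
  shows "x \<sqsubseteq>\<^bsub>weak\<^esub> g \<otimes> x \<longleftrightarrow> len (g \<otimes> x) = len g + len x"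
  using assms by (simp add: weak_le_iff m_assoc)

lemma weak_lower_semilattice: "lower_semilattice weak"
proof -
  have eq: "(.=\<^bsub>weak\<^esub>) = (=)" by (simp add: left_weak_order_def)
  show ?thesis
  proof (unfold_locales; (unfold eq carrier_weak)?)
    fix x y z
    assume c: "x \<in> carrier W" "y \<in> carrier W"
    show "x = y" if "x \<sqsubseteq>\<^bsub>weak\<^esub> y" "y \<sqsubseteq>\<^bsub>weak\<^esub> x"
    proof -
      have "prefix_le (inv x) (inv y)" "prefix_le (inv y) (inv x)"
        using that c by (simp_all add: weak_le_iff_prefix_le)
      then have "inv x = inv y"
        using c by (intro prefix_le_len_antisym prefix_le_len) auto
      then have "inv (inv x) = inv (inv y)" by simp
      then show ?thesis using c by simp
    qed
    show "x \<sqsubseteq>\<^bsub>weak\<^esub> z" if "x \<sqsubseteq>\<^bsub>weak\<^esub> y" "y \<sqsubseteq>\<^bsub>weak\<^esub> z" "z \<in> carrier W"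
      using that c prefix_le_trans[of "inv x" "inv y" "inv z"]
      by (auto simp: weak_le_iff_prefix_le)
    obtain m where m: "m \<in> carrier W" "prefix_le m (inv x)" "prefix_le m (inv y)"
      "\<And>u. u \<in> carrier W \<Longrightarrow> prefix_le u (inv x) \<Longrightarrow> prefix_le u (inv y) \<Longrightarrow> prefix_le u m"
      using prefix_meet_exists[of "inv x" "inv y"] c by auto
    \<comment> \<open>Inversion turns the prefix meet of \<open>inv x\<close> and
      \<open>inv y\<close> into the meet of \<open>x\<close> and \<open>y\<close>.\<close>
    have "greatest weak (inv m) (Lower weak {x, y})"
      using m c by (intro greatest_LowerI) (auto simp: weak_le_iff_prefix_le Lower_def)
    then show "\<exists>m. greatest weak m (Lower weak {x, y})" by blast
  qed (auto simp: weak_le_iff_prefix_le prefix_le_refl)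
qed

end

section \<open>Classes of a semilattice congruence\<close>

context lower_semilattice
begin

text \<open>The meet of \<open>m\<close> and \<open>y\<close> stays in the class and lies below
  \<open>m\<close>, so it equals \<open>m\<close> by minimality.\<close>

lemma congruence_minimal_le:
  assumes "semilattice_congruence L r" "minimal_in L (r `` {w}) m" "(w, y) \<in> r"
  shows "m \<sqsubseteq> y"
proof -
  have r: "equiv (carrier L) r" and m: "(w, m) \<in> r"
    using assms by (auto simp: semilattice_congruence_def minimal_in_def)
  have c: "m \<in> carrier L" "y \<in> carrier L"
    using r m assms(3) by (auto simp: equiv_def refl_on_def)
  have "(m, y) \<in> r" "(m, m) \<in> r"
    using r m assms(3) by (meson equivE symE transE)+
  then have "(m \<sqinter> m, m \<sqinter> y) \<in> r"
    using assms(1) by (simp add: semilattice_congruence_def)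
  moreover have "m \<sqinter> m = m"
    using c by (intro le_antisym meet_left meet_le) auto
  ultimately have "(w, m \<sqinter> y) \<in> r"
    using r m by (metis equivE transE)
  then have "m \<sqinter> y = m"
    using assms(2) c meet_left by (auto simp: minimal_in_def)
  then show ?thesis using c meet_right by metis
qed

lemma pi_down_eqI:
  assumes "semilattice_congruence L r" "minimal_in L (r `` {w}) m"
  shows "pi_down L r w = m"
  unfolding pi_down_def
proof (rule the_equality)
  fix m' assume "minimal_in L (r `` {w}) m'"
  then show "m' = m"
    using congruence_minimal_le[OF assms, of m'] assms(2) by (auto simp: minimal_in_def)
qed (rule assms(2))

text \<open>Meeting the related pair \<open>x\<close>, \<open>z\<close> with \<open>y\<close> yields
  the pair \<open>x\<close>, \<open>y\<close>.\<close>

lemma congruence_convex: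
  assumes "semilattice_congruence L r" "(x, z) \<in> r" "x \<sqsubseteq> y" "y \<sqsubseteq> z" "y \<in> carrier L"
  shows "(x, y) \<in> r"
proof -
  have r: "equiv (carrier L) r" using assms by (simp add: semilattice_congruence_def)
  then have c: "x \<in> carrier L" "z \<in> carrier L" "(y, y) \<in> r"
    using assms by (auto simp: equiv_def refl_on_def)
  then have "(x \<sqinter> y, z \<sqinter> y) \<in> r"
    using assms by (simp add: semilattice_congruence_def)
  moreover have "x \<sqinter> y = x" "z \<sqinter> y = y"
    using assms c by (auto intro!: le_antisym meet_le meet_left meet_right)
  ultimately show ?thesis by simp
qed

end

section \<open>The map between fibres of the stack-sorting operator\<close>

context coxeter_group
begin

text \<open>The witness has least length, and lengths strictly increase along the order.\<close>

lemma ex_minimal_in_weak: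
  assumes "A \<subseteq> carrier W" "A \<noteq> {}"
  shows "\<exists>m. minimal_in weak A m"
proof -
  obtain m where m: "m \<in> A" "\<And>y. y \<in> A \<Longrightarrow> len m \<le> len y"
    using assms(2) ex_has_least_nat[of "\<lambda>x. x \<in> A" _ len] by blast
  have "y = m" if "y \<in> A" "y \<sqsubseteq>\<^bsub>weak\<^esub> m" for y
  proof -
    have c: "y \<in> carrier W" "m \<in> carrier W" using that m assms(1) by auto
    then have "prefix_le (inv y) (inv m)" using that weak_le_iff_prefix_le by simp
    then have "inv y = inv m"
      using prefix_le_len_antisym[of "inv y" "inv m"] m(2)[OF that(1)] c by (simp add: len_inv)
    then show ?thesis using c by (metis inv_inv)
  qed
  then show ?thesis using m(1) unfolding minimal_in_def by blast
qed

lemma pi_down_minimal: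
  assumes "semilattice_congruence weak r" "u \<in> carrier W"
  shows "minimal_in weak (r `` {u}) (pi_down weak r u)"
proof -
  interpret weak: lower_semilattice weak by (rule weak_lower_semilattice)
  have r: "equiv (carrier W) r" using assms by (simp add: semilattice_congruence_def)
  then have "(u, u) \<in> r" using assms(2) by (auto simp: equiv_def refl_on_def)
  moreover have "r `` {u} \<subseteq> carrier W" using r by (auto simp: equiv_def refl_on_def)
  ultimately obtain m where "minimal_in weak (r `` {u}) m"
    using ex_minimal_in_weak[of "r `` {u}"] by blast
  with weak.pi_down_eqI[OF assms(1) this] show ?thesis by simp
qed

lemma stack_sort_preimage:
  assumes r: "semilattice_congruence weak r"
    and c: "v \<in> carrier W" "w \<in> carrier W" "u \<in> carrier W"
    and "v \<sqsubseteq>\<^bsub>weak\<^esub> w" "stack_sort W S r u = w"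
  shows "stack_sort W S r (v \<otimes> inv w \<otimes> u) = v"
proof -
  interpret weak: lower_semilattice weak by (rule weak_lower_semilattice)
  have eqv: "equiv (carrier W) r" using r by (simp add: semilattice_congruence_def)
  define x where "x = pi_down weak r u"
  have min: "minimal_in weak (r `` {u}) x"
    unfolding x_def by (rule pi_down_minimal[OF r c(3)])
  then have ux: "(u, x) \<in> r" by (simp add: minimal_in_def)
  then have x: "x \<in> carrier W" using eqv by (auto simp: equiv_def refl_on_def)
  have "w = u \<otimes> inv x" using assms(6) by (simp add: stack_sort_def x_def)
  then have u: "u = w \<otimes> x" using c x by (simp add: m_assoc)
  then have vx: "v \<otimes> inv w \<otimes> u = v \<otimes> x" using c x by (simp add: m_assoc)
  have "(u, u) \<in> r" using eqv c(3) by (auto simp: equiv_def refl_on_def)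
  then have "x \<sqsubseteq>\<^bsub>weak\<^esub> u" by (rule weak.congruence_minimal_le[OF r min])
  then have lu: "len u = len w + len x" using weak_le_mult[of x w] u x c by simp
  have lw: "len w = len (w \<otimes> inv v) + len v" using assms(5) weak_le_iff by simp
  \<comment> \<open>This factorization squeezes the lengths: \<open>len u\<close> is at most
    \<open>len (w inv v) + len (v x)\<close>, which is at most
    \<open>len (w inv v) + len v + len x = len u\<close>. Both bounds are therefore
    equalities.\<close>
  have uv: "u = w \<otimes> inv v \<otimes> (v \<otimes> x)" using u c x by (simp add: m_assoc)
  have "len u \<le> len (w \<otimes> inv v) + len (v \<otimes> x)"
    unfolding uv using c x by (intro len_mult_le) auto
  moreover have "len (v \<otimes> x) \<le> len v + len x"
    using c x by (intro len_mult_le) auto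
  ultimately have lv: "len (v \<otimes> x) = len v + len x"
    and "len u = len (w \<otimes> inv v) + len (v \<otimes> x)"
    using lu lw by simp_all
  then have "x \<sqsubseteq>\<^bsub>weak\<^esub> v \<otimes> x" "v \<otimes> x \<sqsubseteq>\<^bsub>weak\<^esub> u"
    using weak_le_mult[of x v] weak_le_mult[of "v \<otimes> x" "w \<otimes> inv v"] uv c x by simp_all
  moreover have xu: "(x, u) \<in> r" using ux eqv by (meson equivE symE)
  ultimately have "(x, v \<otimes> x) \<in> r"
    using weak.congruence_convex[OF r, of x u "v \<otimes> x"] c x by simp
  then have "(u, v \<otimes> x) \<in> r" using ux eqv by (meson equivE transE)
  \<comment> \<open>\<open>pi_down\<close> depends on its argument only through the class, so its
    value at \<open>v x\<close> is again \<open>x\<close>.\<close>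
  then have "r `` {v \<otimes> x} = r `` {u}" using equiv_class_eq[OF eqv] by blast
  then have "pi_down weak r (v \<otimes> x) = x"
    unfolding x_def by (simp add: pi_down_def)
  then show ?thesis
    unfolding vx stack_sort_def using c x by (simp add: m_assoc)
qed

end

theorem theorem4p4:
  fixes W :: "('a, 'b) monoid_scheme" and S :: "'a set" and r :: "'a rel" and v w :: 'a
  assumes "coxeter_system W S"
    and "semilattice_congruence (left_weak_order W S) r"
    and "essential W r"
    and "v \<in> carrier W" and "w \<in> carrier W"
    and "v \<sqsubseteq>\<^bsub>left_weak_order W S\<^esub> w"
  shows "{u \<in> carrier W. stack_sort W S r u = w} \<lesssim> {u \<in> carrier W. stack_sort W S r u = v}"
proof -
  interpret coxeter_group W S by unfold_locales (rule assms(1))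
  \<comment> \<open>Left multiplication by a fixed element is injective; this one replaces the left
    factor \<open>w\<close> of \<open>w x\<close> by \<open>v\<close>.\<close>
  let ?f = "\<lambda>u. v \<otimes>\<^bsub>W\<^esub> inv\<^bsub>W\<^esub> w \<otimes>\<^bsub>W\<^esub> u"
  have "inj_on ?f {u \<in> carrier W. stack_sort W S r u = w}"
    using assms(4,5) by (auto simp: inj_on_def)
  moreover have "?f ` {u \<in> carrier W. stack_sort W S r u = w} \<subseteq>
      {u \<in> carrier W. stack_sort W S r u = v}"
    using stack_sort_preimage[OF assms(2,4,5) _ assms(6)] assms(4,5) by auto
  ultimately show ?thesis unfolding lepoll_def by blast
qed

end
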